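(* Work with hereditarily finite sets built over a single atom $\heartsuit$, and for a set $M$ put $M_L=\{A: A\in M,\ \heartsuit\notin A\}$ and $M_R=\{A: A\cup\{\heartsuit\}\in M,\ \heartsuit\notin A\}$. Define the class $\mathcal P_\in$ recursively: a finite set $M$ belongs to $\mathcal P_\in$ if and only if (1) $\heartsuit\notin M$, $M_L\cup M_R\subseteq \mathcal P_\in$ and $M_L\cap M_R=\emptyset$; (2) for each $A\in M_L$ and $B\in M_R$ we have $(\{A\}\cup A_R)\cap(\{B\}\cup B_L)\neq\emptyset$; (3) $A_L\subseteq M_L$ for each $A\in M_L$; (4) $B_R\subseteq M_R$ for each $B\in M_R$. For $M,N\in\mathcal P_\in$ put $M<_\in N$ if $(\{M\}\cup M_R)\cap(\{N\}\cup N_L)\neq\emptyset$, and $M\le_\in N$ if $M<_\in N$ or $M=N$. Then $(\mathcal P_\in,\le_\in)$ is a partially ordered set which is generic for the class of all countable partial orders: it is countable, ultrahomogeneous, and every countable partial order embeds into it.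
   Context: A structure is ultrahomogeneous if every isomorphism between two finite induced substructures extends to an automorphism of the whole structure. An embedding of partial orders is an injective map $f$ with $x\le y$ iff $f(x)\le f(y)$. *)

theory Defs
  imports "HOL-Library.FSet" "HOL-Library.Countable_Set"
begin

section \<open>Hereditarily finite sets over one atom\<close>

datatype hf = Heart | HSet "hf fset"

primrec elts :: "hf \<Rightarrow> hf set" where
  "elts Heart = {}"
| "elts (HSet F) = fset F"

text \<open>
  In both definitions below the bound \<open>A\<close> of the mathematics ranges over sets, so it is written
  \<open>HSet F\<close>; accordingly \<open>HSet (finsert Heart F)\<close> is the union of \<open>A\<close> with the singleton of the atom.
\<close>

definition left_part :: "hf \<Rightarrow> hf set" where
  "left_part M = {HSet F | F. HSet F \<in> elts M \<and> Heart |\<notin>| F}"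

definition right_part :: "hf \<Rightarrow> hf set" where
  "right_part M = {HSet F | F. HSet (finsert Heart F) \<in> elts M \<and> Heart |\<notin>| F}"

section \<open>The class of sets and its order\<close>

definition less_in :: "hf \<Rightarrow> hf \<Rightarrow> bool" where
  "less_in M N \<longleftrightarrow> ({M} \<union> right_part M) \<inter> ({N} \<union> left_part N) \<noteq> {}"

text \<open>
  The defining equivalence of the class is the fact \<open>P_in.simps\<close>.  Since the elements of the left and
  right part of \<open>M\<close> are of smaller rank than \<open>M\<close>, that equivalence has only one solution, so taking
  the least one is no restriction.  The premise \<open>M \<noteq> Heart\<close> says that \<open>M\<close> is a set.
\<close>

inductive_set P_in :: "hf set" where
  P_inI: "M \<in> P_in" if
    "M \<noteq> Heart"
    "Heart \<notin> elts M"
    "\<And>A. A \<in> left_part M \<union> right_part M \<Longrightarrow> A \<in> P_in"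
    "left_part M \<inter> right_part M = {}"
    "\<And>A B. A \<in> left_part M \<Longrightarrow> B \<in> right_part M \<Longrightarrow>
      ({A} \<union> right_part A) \<inter> ({B} \<union> left_part B) \<noteq> {}"
    "\<And>A. A \<in> left_part M \<Longrightarrow> left_part A \<subseteq> left_part M"
    "\<And>B. B \<in> right_part M \<Longrightarrow> right_part B \<subseteq> right_part M"

text \<open>
  Read literally, \<open>less_in M M\<close> holds for every \<open>M\<close> (the set \<open>M\<close> itself is in the intersection), so
  the disjunct \<open>M = N\<close> is redundant; it is kept as in the mathematics.
\<close>

definition le_in :: "hf rel" where
  "le_in = {(M, N). M \<in> P_in \<and> N \<in> P_in \<and> (less_in M N \<or> M = N)}"

section \<open>Embeddings and ultrahomogeneity\<close>

text \<open>
  A structure is a carrier with a binary relation; only pairs of carrier elements are inspected,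
  so \<open>(S, r)\<close> with \<open>S \<subseteq> A\<close> denotes the substructure of \<open>(A, r)\<close> induced on \<open>S\<close>.
\<close>

definition is_embedding :: "'a set \<Rightarrow> 'a rel \<Rightarrow> 'b set \<Rightarrow> 'b rel \<Rightarrow> ('a \<Rightarrow> 'b) \<Rightarrow> bool" where
  "is_embedding A r B s f \<longleftrightarrow>
     inj_on f A \<and> f ` A \<subseteq> B \<and> (\<forall>x\<in>A. \<forall>y\<in>A. (x, y) \<in> r \<longleftrightarrow> (f x, f y) \<in> s)"

definition is_isomorphism :: "'a set \<Rightarrow> 'a rel \<Rightarrow> 'b set \<Rightarrow> 'b rel \<Rightarrow> ('a \<Rightarrow> 'b) \<Rightarrow> bool" where
  "is_isomorphism A r B s f \<longleftrightarrow>
     bij_betw f A B \<and> (\<forall>x\<in>A. \<forall>y\<in>A. (x, y) \<in> r \<longleftrightarrow> (f x, f y) \<in> s)"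

definition ultrahomogeneous :: "'a set \<Rightarrow> 'a rel \<Rightarrow> bool" where
  "ultrahomogeneous A r \<longleftrightarrow>
     (\<forall>S T f. finite S \<and> S \<subseteq> A \<and> finite T \<and> T \<subseteq> A \<and> is_isomorphism S r T r f \<longrightarrow>
       (\<exists>g. is_isomorphism A r A r g \<and> (\<forall>x\<in>S. g x = f x)))"

end

theory Submission imports Defs begin

text \<open>
  Every witness of \<open>A \<le> B\<close> followed by a witness of \<open>B \<le> C\<close> is inherited by \<open>A\<close> or \<open>C\<close>, or
  gives an element of the left part of \<open>B\<close> below an element of its right part, whose own witness
  serves for \<open>A \<le> C\<close>; this is transitivity, and antisymmetry follows by induction on the rank.
  Genericity rests on one-point extensions. Let \<open>L\<close> be a down-set and \<open>R\<close> an up-set of a finite \<open>S\<close>,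
  with \<open>L\<close> strictly below \<open>R\<close>. The set whose left and right parts are the elements of \<open>L\<close> with their
  left parts and the elements of \<open>R\<close> with their right parts lies above \<open>L\<close> and below \<open>R\<close>. It is made
  different from, and otherwise incomparable with, the elements of \<open>S\<close> by adding to its left part
  one element below everything in \<open>S\<close>, of larger rank than everything in \<open>S\<close>. Universality and
  ultrahomogeneity then come from going forth, and back and forth.
\<close>

section \<open>Left and right parts\<close>

text \<open>Each part is joined with its set because a witness of \<open>less_in\<close> is allowed
  to be one of the two sets compared. The closure conditions of the class become transitivity of
  membership in cones.\<close>

abbreviation left_cone :: "hf \<Rightarrow> hf set" where
  "left_cone M \<equiv> insert M (left_part M)"

abbreviation right_cone :: "hf \<Rightarrow> hf set" where
  "right_cone M \<equiv> insert M (right_part M)"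

lemma less_in_iff: "less_in M N \<longleftrightarrow> (\<exists>W \<in> right_cone M. W \<in> left_cone N)"
  unfolding less_in_def by blast

lemma less_in_refl [simp]: "less_in M M"
  by (auto simp: less_in_iff)

text \<open>\<open>size\<close> serves as the rank: on \<open>HSet F\<close> it dominates the sum of
  \<open>Suc (size x)\<close> over all members, hence exceeds the size of each.\<close>

lemma size_elts_less: "A \<in> elts M \<Longrightarrow> size A < size M"
proof (cases M)
  case (HSet F)
  assume "A \<in> elts M"
  with HSet have "A \<in> fset F" by simp
  then have "Suc (size A) \<le> (\<Sum>x\<in>fset F. Suc (size x))"
    by (rule member_le_sum) auto
  with HSet show ?thesis by simp
qed simp

lemma size_left_part_less:
  assumes "A \<in> left_part M"
  shows "size A < size M"
  using assms size_elts_less by (auto simp: left_part_def)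

text \<open>\<open>A\<close> itself need not be a member of \<open>M\<close>, only \<open>A\<close>
  with the atom adjoined, and adjoining the atom does not lower the size.\<close>

lemma size_right_part_less:
  assumes "A \<in> right_part M"
  shows "size A < size M"
proof -
  obtain F where F: "A = HSet F" "HSet (finsert Heart F) \<in> elts M" "Heart |\<notin>| F"
    using assms by (auto simp: right_part_def)
  then have "size A \<le> size (HSet (finsert Heart F))"
    by simp
  with size_elts_less[OF F(2)] show ?thesis by simp
qed

lemma finite_elts: "finite (elts M)"
  by (cases M) auto

lemma finite_left_part: "finite (left_part M)"
  by (rule finite_subset[OF _ finite_elts[of M]]) (auto simp: left_part_def)

text \<open>Deleting the atom maps the finitely many members of \<open>M\<close> onto a set
  containing the right part.\<close>

lemma finite_right_part: "finite (right_part M)"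
proof (rule finite_subset)
  show "right_part M \<subseteq> (\<lambda>A. HSet (Abs_fset (elts A - {Heart}))) ` elts M"
  proof
    fix A assume "A \<in> right_part M"
    then obtain F where F: "A = HSet F" "HSet (finsert Heart F) \<in> elts M" "Heart |\<notin>| F"
      by (auto simp: right_part_def)
    have "Abs_fset (elts (HSet (finsert Heart F)) - {Heart}) = F"
      using F(3) by (simp add: fset_inverse)
    with F(1) show "A \<in> (\<lambda>A. HSet (Abs_fset (elts A - {Heart}))) ` elts M"
      by (intro image_eqI[OF _ F(2)]) simp
  qed
qed (simp add: finite_elts)

text \<open>The members of \<open>X\<close> are put in unchanged and those of \<open>Y\<close> are
  tagged with the atom. As no member of either set contains the atom, the tag tells the two kinds
  apart and can be removed again.\<close>

lemma ex_left_right_part: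
  assumes "finite X" "finite Y"
    and sets: "\<And>A. A \<in> X \<union> Y \<Longrightarrow> A \<noteq> Heart \<and> Heart \<notin> elts A"
  obtains M where "M \<noteq> Heart" "Heart \<notin> elts M" "left_part M = X" "right_part M = Y"
proof -
  define E where "E = X \<union> (\<lambda>B. HSet (Abs_fset (insert Heart (elts B)))) ` Y"
  define M where "M = HSet (Abs_fset E)"
  have "finite E"
    using assms(1,2) by (simp add: E_def)
  then have elts_M: "elts M = E"
    by (simp add: M_def Abs_fset_inverse)
  have ins: "HSet (Abs_fset (insert Heart (elts (HSet F)))) = HSet (finsert Heart F)" for F
    by (metis elts.simps(2) finsert.rep_eq fset_inverse)
  have set_E: "HSet F \<in> E \<longleftrightarrow> HSet F \<in> X" if "Heart |\<notin>| F" for F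
  proof
    assume "HSet F \<in> E"
    moreover have "HSet F \<noteq> HSet (Abs_fset (insert Heart (elts B)))" if "B \<in> Y" for B
      using \<open>Heart |\<notin>| F\<close> ins sets that by (cases B) auto
    ultimately show "HSet F \<in> X"
      unfolding E_def by blast
  qed (simp add: E_def)
  have set_E': "HSet (finsert Heart F) \<in> E \<longleftrightarrow> HSet F \<in> Y" if F: "Heart |\<notin>| F" for F
  proof
    assume "HSet (finsert Heart F) \<in> E"
    moreover have "HSet (finsert Heart F) \<notin> X"
      using sets by force
    ultimately obtain B where B: "B \<in> Y"
      "HSet (finsert Heart F) = HSet (Abs_fset (insert Heart (elts B)))"
      by (auto simp: E_def)
    obtain G where G: "B = HSet G" "Heart |\<notin>| G"
      using sets[of B] B(1) by (cases B) auto
    \<comment> \<open>The tag cancels, since neither \<open>F\<close> nor \<open>G\<close> contains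
      the atom.\<close>
    have "finsert Heart F = finsert Heart G"
      using B(2) G(1) ins by simp
    with F G(2) have "F = G"
      by (metis finsert_ident)
    with B G show "HSet F \<in> Y" by simp
  next
    assume "HSet F \<in> Y"
    then show "HSet (finsert Heart F) \<in> E"
      unfolding E_def using ins by (metis UnI2 image_eqI)
  qed
  have set_form: "\<exists>F. A = HSet F \<and> Heart |\<notin>| F" if "A \<in> X \<union> Y" for A
    using sets[OF that] by (cases A) auto
  have "left_part M = X"
    using set_E set_form unfolding left_part_def elts_M by blast
  moreover have "right_part M = Y"
    using set_E' set_form unfolding right_part_def elts_M by blast
  moreover have "Heart \<notin> E"
    using sets by (auto simp: E_def)
  ultimately show thesis
    using that[of M] elts_M by (simp add: M_def)
qed

section \<open>The partial order\<close>

lemma P_in_set: "M \<in> P_in \<Longrightarrow> M \<noteq> Heart \<and> Heart \<notin> elts M"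
  by (auto elim: P_in.cases)

lemma left_part_in_P_in: "M \<in> P_in \<Longrightarrow> A \<in> left_part M \<Longrightarrow> A \<in> P_in"
  by (auto elim: P_in.cases)

lemma right_part_in_P_in: "M \<in> P_in \<Longrightarrow> A \<in> right_part M \<Longrightarrow> A \<in> P_in"
  by (auto elim: P_in.cases)

lemma left_part_disjoint_right_part:
  "M \<in> P_in \<Longrightarrow> A \<in> left_part M \<Longrightarrow> A \<notin> right_part M"
  by (auto elim: P_in.cases)

lemma left_part_less_in_right_part:
  "M \<in> P_in \<Longrightarrow> A \<in> left_part M \<Longrightarrow> B \<in> right_part M \<Longrightarrow> less_in A B"
  unfolding less_in_def by (erule P_in.cases) blast

lemma left_part_trans:
  "M \<in> P_in \<Longrightarrow> A \<in> left_part M \<Longrightarrow> B \<in> left_part A \<Longrightarrow> B \<in> left_part M"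
  by (erule P_in.cases) blast

lemma right_part_trans:
  "M \<in> P_in \<Longrightarrow> A \<in> right_part M \<Longrightarrow> B \<in> right_part A \<Longrightarrow> B \<in> right_part M"
  by (erule P_in.cases) blast

lemma left_cone_trans:
  "M \<in> P_in \<Longrightarrow> A \<in> left_cone M \<Longrightarrow> B \<in> left_cone A \<Longrightarrow> B \<in> left_cone M"
  using left_part_trans by blast

lemma right_cone_trans:
  "M \<in> P_in \<Longrightarrow> A \<in> right_cone M \<Longrightarrow> B \<in> right_cone A \<Longrightarrow> B \<in> right_cone M"
  using right_part_trans by blast

lemma left_part_less_in: "A \<in> left_cone M \<Longrightarrow> less_in A M"
  by (auto simp: less_in_iff)

lemma right_part_greater_in: "A \<in> right_cone M \<Longrightarrow> less_in M A"
  by (auto simp: less_in_iff)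

section \<open>Transitivity and antisymmetry\<close>

lemma less_in_trans:
  assumes P: "A \<in> P_in" "B \<in> P_in" "C \<in> P_in" and "less_in A B" "less_in B C"
  shows "less_in A C"
proof -
  obtain W1 W2 where W1: "W1 \<in> right_cone A" "W1 \<in> left_cone B"
    and W2: "W2 \<in> right_cone B" "W2 \<in> left_cone C"
    using assms(4,5) by (auto simp: less_in_iff)
  consider "W1 = B" | "W2 = B" | "W1 \<in> left_part B" "W2 \<in> right_part B"
    using W1(2) W2(1) by blast
  then show ?thesis
  proof cases
    case 1
    then show ?thesis
      using W1 W2 right_cone_trans[OF P(1)] by (auto simp: less_in_iff)
  next
    case 2
    then show ?thesis
      using W1 W2 left_cone_trans[OF P(3)] by (auto simp: less_in_iff)
  next
    case 3
    \<comment> \<open>Condition (2) for \<open>B\<close> compares \<open>W1\<close> with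
      \<open>W2\<close>. Its witness \<open>V\<close> passes into the right cone of \<open>A\<close>
      through \<open>W1\<close> and into the left cone of \<open>C\<close> through
      \<open>W2\<close>.\<close>
    then obtain V where V: "V \<in> right_cone W1" "V \<in> left_cone W2"
      using left_part_less_in_right_part[OF P(2)] less_in_iff by blast
    show ?thesis
      unfolding less_in_iff
      using left_cone_trans[OF P(3) W2(2) V(2)] right_cone_trans[OF P(1) W1(1) V(1)] ..
  qed
qed

text \<open>If \<open>A\<close> and \<open>B\<close> differ, most combinations of the two witnesses
  put one set into both parts of \<open>A\<close> or of \<open>B\<close>, or into its own left or
  right part. In the remaining one the witnesses are themselves mutually comparable and of smaller
  rank, so the induction hypothesis identifies them.\<close>

lemma less_in_antisym:
  assumes "A \<in> P_in" "B \<in> P_in" "less_in A B" "less_in B A"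
  shows "A = B"
  using assms
proof (induction "size A" arbitrary: A B rule: less_induct)
  case less
  note P = less.prems(1,2)
  obtain W1 W2 where W1: "W1 \<in> right_cone A" "W1 \<in> left_cone B"
    and W2: "W2 \<in> right_cone B" "W2 \<in> left_cone A"
    using less.prems(3,4) by (auto simp: less_in_iff)
  show ?case
  proof (rule ccontr)
    assume "A \<noteq> B"
    then consider "A \<in> left_part B" | "B \<in> right_part A" | "W1 \<in> right_part A" "W1 \<in> left_part B"
      using W1 by blast
    then show False
    proof cases
      case 1
      \<comment> \<open>The left part of \<open>A\<close> is contained in that of \<open>B\<close>,
        so \<open>W2\<close> is in both parts of \<open>B\<close>, or equals \<open>B\<close> and
        contradicts rank.\<close>
      then have "W2 \<in> left_part B"
        using W2(2) left_part_trans[OF P(2)] by blast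
      moreover from this have "W2 \<noteq> B"
        using size_left_part_less by blast
      ultimately show False
        using W2(1) left_part_disjoint_right_part[OF P(2)] by blast
    next
      case 2
      then have "W2 \<in> right_part A"
        using W2(1) right_part_trans[OF P(1)] by blast
      moreover from this have "W2 \<noteq> A"
        using size_right_part_less by blast
      ultimately show False
        using W2(2) left_part_disjoint_right_part[OF P(1)] by blast
    next
      case 3
      consider "W2 = A" "A \<in> right_part B" | "W2 = B" "B \<in> left_part A"
        | "W2 \<in> right_part B" "W2 \<in> left_part A"
        using W2 \<open>A \<noteq> B\<close> by blast
      then show False
      proof cases
        case 1
        with 3 show False
          using right_part_trans[OF P(2)] left_part_disjoint_right_part[OF P(2)] by blast
      next
        case 2
        with 3 show False
          using left_part_trans[OF P(1)] left_part_disjoint_right_part[OF P(1)] by blast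
      next
        case 4: 3
        \<comment> \<open>Condition (2) for \<open>B\<close> gives one comparison and condition (2)
          for \<open>A\<close> the other; the common value would lie in both parts of
          \<open>A\<close>.\<close>
        have "W1 = W2"
        proof (rule less.hyps)
          show "size W1 < size A" using 3 size_right_part_less by blast
          show "W1 \<in> P_in" "W2 \<in> P_in"
            using 3 4 P left_part_in_P_in by blast+
          show "less_in W1 W2" using 3 4 left_part_less_in_right_part[OF P(2)] by blast
          show "less_in W2 W1" using 3 4 left_part_less_in_right_part[OF P(1)] by blast
        qed
        with 3 4 show False
          using left_part_disjoint_right_part[OF P(1)] by blast
      qed
    qed
  qed
qed

lemma le_in_iff: "(M, N) \<in> le_in \<longleftrightarrow> M \<in> P_in \<and> N \<in> P_in \<and> less_in M N"
  by (auto simp: le_in_def)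

lemma partial_order_on_le_in: "partial_order_on P_in le_in"
  unfolding partial_order_on_def preorder_on_def refl_on_def
  by (auto simp: le_in_iff intro!: transI antisymI intro: less_in_trans less_in_antisym)

text \<open>Countability of \<open>P_in\<close> is then immediate, as for every set over this
  type.\<close>

instance hf :: countable
  by countable_datatype

section \<open>One-point extensions\<close>

text \<open>The conditions on \<open>L\<close> and \<open>R\<close> are exactly those met by the
  sets of points of \<open>S\<close> below and above a new point in some larger partial order. The
  property thus says that every one-point extension of a finite suborder is realised.\<close>

definition one_point_extensible :: "'a set \<Rightarrow> 'a rel \<Rightarrow> bool" where
  "one_point_extensible A r \<longleftrightarrow>
     (\<forall>S L R. finite S \<and> S \<subseteq> A \<and> L \<subseteq> S \<and> R \<subseteq> S \<and> L \<inter> R = {} \<and> L \<times> R \<subseteq> r \<and>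
        (\<forall>x\<in>S. \<forall>l\<in>L. (x, l) \<in> r \<longrightarrow> x \<in> L) \<and> (\<forall>x\<in>S. \<forall>u\<in>R. (u, x) \<in> r \<longrightarrow> x \<in> R) \<longrightarrow>
       (\<exists>m\<in>A. \<forall>x\<in>S. x \<noteq> m \<and> ((x, m) \<in> r \<longleftrightarrow> x \<in> L) \<and> ((m, x) \<in> r \<longleftrightarrow> x \<in> R)))"

text \<open>With an empty left part, conditions (2) and (3) are vacuous, so it suffices to close
  \<open>S\<close> under right parts. The empty left part also lets \<open>Z\<close> be added to
  another left part without breaking condition (3).\<close>

lemma ex_P_in_below:
  assumes "finite S" "S \<subseteq> P_in"
  obtains Z where "Z \<in> P_in" "left_part Z = {}" "S \<subseteq> right_part Z"
proof -
  define Y where "Y = (\<Union>s\<in>S. right_cone s)"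
  have YP: "Y \<subseteq> P_in"
    using assms(2) right_part_in_P_in by (auto simp: Y_def)
  have "finite Y"
    using assms(1) finite_right_part by (auto simp: Y_def)
  then obtain Z where Z: "Z \<noteq> Heart" "Heart \<notin> elts Z" "left_part Z = {}" "right_part Z = Y"
    using ex_left_right_part[of "{}" Y] YP P_in_set by blast
  have "right_part B \<subseteq> Y" if "B \<in> Y" for B
    using that assms(2) right_part_trans unfolding Y_def by blast
  moreover have "A \<in> P_in" if "A \<in> left_part Z \<union> right_part Z" for A
    using that Z(3,4) YP by auto
  ultimately have "Z \<in> P_in"
    using Z by - (rule P_inI, auto)
  with Z show thesis
    using that[of Z] by (auto simp: Y_def)
qed

lemma one_point_extensible_P_in: "one_point_extensible P_in le_in"
  unfolding one_point_extensible_def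
proof (intro allI impI, elim conjE)
  fix S L R
  assume S: "finite S" "S \<subseteq> P_in" and L: "L \<subseteq> S" and R: "R \<subseteq> S" and disj: "L \<inter> R = {}"
    and LR: "L \<times> R \<subseteq> le_in"
    and down: "\<forall>x\<in>S. \<forall>l\<in>L. (x, l) \<in> le_in \<longrightarrow> x \<in> L"
    and up: "\<forall>x\<in>S. \<forall>u\<in>R. (u, x) \<in> le_in \<longrightarrow> x \<in> R"
  have LP: "L \<subseteq> P_in" and RP: "R \<subseteq> P_in"
    using L R S by auto
  obtain Z where Z: "Z \<in> P_in" "left_part Z = {}" "S \<subseteq> right_part Z"
    using ex_P_in_below[OF S] .
  \<comment> \<open>\<open>X\<close> and \<open>Y\<close> become the parts of the new point; taking
    cones gives the closure demanded by (3) and (4).\<close>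
  define X where "X = insert Z (\<Union>l\<in>L. left_cone l)"
  define Y where "Y = (\<Union>u\<in>R. right_cone u)"
  have XP: "X \<subseteq> P_in"
    using LP Z(1) left_part_in_P_in by (auto simp: X_def)
  have YP: "Y \<subseteq> P_in"
    using RP right_part_in_P_in by (auto simp: Y_def)
  \<comment> \<open>\<open>Z\<close> outranks all cones over \<open>S\<close>, so it is never a
    witness between an element of \<open>S\<close> and something else.\<close>
  have size_Z: "size V < size Z" if "x \<in> S" "V \<in> left_cone x \<or> V \<in> right_cone x" for x V
  proof -
    have "size x < size Z"
      using that(1) Z(3) size_right_part_less by blast
    moreover have "size V \<le> size x"
      using that(2) size_left_part_less size_right_part_less by (metis insertE less_or_eq_imp_le)
    ultimately show ?thesis by simp
  qed
  have "finite X" "finite Y"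
    using finite_subset[OF L S(1)] finite_subset[OF R S(1)] finite_left_part finite_right_part
    by (auto simp: X_def Y_def)
  then obtain M where M: "M \<noteq> Heart" "Heart \<notin> elts M" "left_part M = X" "right_part M = Y"
    using ex_left_right_part[of X Y] XP YP P_in_set by blast
  have X_cases: "x = Z \<or> (\<exists>l\<in>L. less_in x l)" if "x \<in> X" for x
    using that left_part_less_in by (auto simp: X_def)
  have Y_cases: "\<exists>u\<in>R. less_in u y" if "y \<in> Y" for y
    using that right_part_greater_in by (auto simp: Y_def)
  have Z_notin: "Z \<notin> Y"
    using size_Z R by (auto simp: Y_def)
  have Z_less: "less_in Z y" if "y \<in> S" for y
    using that Z(3) right_part_greater_in by blast
  have disjoint: "X \<inter> Y = {}"
  proof (rule ccontr)
    assume "X \<inter> Y \<noteq> {}"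
    then obtain x l u where "x \<in> P_in" "l \<in> L" "u \<in> R" "less_in x l" "less_in u x"
      using X_cases Y_cases Z_notin XP by blast
    \<comment> \<open>A common element of \<open>X\<close> and \<open>Y\<close> would put some
      \<open>u\<close> of \<open>R\<close> below some \<open>l\<close> of \<open>L\<close>, hence
      into the down-set \<open>L\<close>.\<close>
    then have "less_in u l"
      using less_in_trans LP RP by blast
    then have "u \<in> L"
      using down \<open>l \<in> L\<close> \<open>u \<in> R\<close> LP RP R by (auto simp: le_in_iff)
    with \<open>u \<in> R\<close> disj show False by blast
  qed
  have XY: "less_in x y" if x: "x \<in> X" and y: "y \<in> Y" for x y
  proof -
    obtain u where u: "u \<in> R" "less_in u y"
      using Y_cases y by blast
    have "less_in x u"
    proof (cases "x = Z")
      case True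
      with u R Z_less show ?thesis by blast
    next
      case False
      then obtain l where "l \<in> L" "less_in x l"
        using X_cases x by blast
      moreover have "less_in l u"
        using LR u \<open>l \<in> L\<close> by (auto simp: le_in_iff)
      ultimately show ?thesis
        using less_in_trans[of x l u] x XP LP RP u(1) by blast
    qed
    with u show ?thesis
      using less_in_trans[of x u y] x y XP YP RP by blast
  qed
  have X_closed: "left_part A \<subseteq> X" if A: "A \<in> X" for A
  proof (cases "A = Z")
    case True
    with Z(2) show ?thesis by simp
  next
    case False
    with A obtain l where "l \<in> L" "A \<in> left_cone l"
      by (auto simp: X_def)
    then have "left_cone A \<subseteq> left_cone l"
      using left_cone_trans LP by (meson subsetD subsetI)
    with \<open>l \<in> L\<close> show ?thesis
      by (auto simp: X_def)
  qed
  have Y_closed: "right_part B \<subseteq> Y" if B: "B \<in> Y" for B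
  proof -
    obtain u where "u \<in> R" "B \<in> right_cone u"
      using B by (auto simp: Y_def)
    then have "right_cone B \<subseteq> right_cone u"
      using right_cone_trans RP by (meson subsetD subsetI)
    with \<open>u \<in> R\<close> show ?thesis
      by (auto simp: Y_def)
  qed
  have MP: "M \<in> P_in"
  proof (rule P_inI)
    show "({A} \<union> right_part A) \<inter> ({B} \<union> left_part B) \<noteq> {}"
      if "A \<in> left_part M" "B \<in> right_part M" for A B
      using XY that M by (simp add: less_in_def)
  qed (use M XP YP disjoint X_closed Y_closed in auto)
  \<comment> \<open>As \<open>Z\<close> is in its left part, \<open>M\<close> also outranks all
    cones over \<open>S\<close>. So \<open>M\<close> is not in \<open>S\<close>, and a witness
    between \<open>M\<close> and an element of \<open>S\<close> must come from \<open>X\<close> or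
    \<open>Y\<close>.\<close>
  have "size Z < size M"
    using M size_left_part_less by (simp add: X_def)
  then have M_notin: "M \<notin> left_cone x" "M \<notin> right_cone x" if "x \<in> S" for x
    using size_Z[OF that] by (meson less_asym)+
  have "x \<in> L" if "x \<in> S" "less_in x M" for x
  proof -
    obtain W where W: "W \<in> right_cone x" "W \<in> left_cone M"
      using \<open>less_in x M\<close> by (auto simp: less_in_iff)
    then have "W \<in> X"
      using M_notin(2)[OF \<open>x \<in> S\<close>] M by auto
    \<comment> \<open>Only \<open>Z\<close> could break the argument, being the one element of
      \<open>X\<close> not known to lie below an element of \<open>L\<close>.\<close>
    moreover have "W \<noteq> Z"
      using W(1) size_Z[OF \<open>x \<in> S\<close>] by blast
    ultimately obtain l where l: "l \<in> L" "less_in W l"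
      using X_cases by blast
    have "less_in x l"
      using less_in_trans[of x W l] W(1) l right_part_greater_in \<open>W \<in> X\<close> \<open>x \<in> S\<close> XP LP S(2)
      by blast
    then show ?thesis
      using down \<open>x \<in> S\<close> l(1) LP S(2) by (auto simp: le_in_iff)
  qed
  moreover have "x \<in> R" if "x \<in> S" "less_in M x" for x
  proof -
    obtain W where W: "W \<in> right_cone M" "W \<in> left_cone x"
      using \<open>less_in M x\<close> by (auto simp: less_in_iff)
    then have "W \<in> Y"
      using M_notin(1)[OF \<open>x \<in> S\<close>] M by auto
    then obtain u where u: "u \<in> R" "less_in u W"
      using Y_cases by blast
    have "less_in u x"
      using less_in_trans[of u W x] W(2) u left_part_less_in \<open>W \<in> Y\<close> \<open>x \<in> S\<close> YP RP S(2)
      by blast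
    then show ?thesis
      using up \<open>x \<in> S\<close> u(1) RP S(2) by (auto simp: le_in_iff)
  qed
  moreover have "less_in l M" if "l \<in> L" for l
    using that M(3) left_part_less_in by (auto simp: X_def)
  moreover have "less_in M u" if "u \<in> R" for u
    using that M(4) right_part_greater_in by (auto simp: Y_def)
  ultimately have "\<forall>x\<in>S. x \<noteq> M \<and> ((x, M) \<in> le_in \<longleftrightarrow> x \<in> L) \<and> ((M, x) \<in> le_in \<longleftrightarrow> x \<in> R)"
    using MP S(2) M_notin(1) by (auto simp: le_in_iff dest: M_notin(1))
  with MP show "\<exists>m\<in>P_in. \<forall>x\<in>S. x \<noteq> m \<and> ((x, m) \<in> le_in \<longleftrightarrow> x \<in> L) \<and> ((m, x) \<in> le_in \<longleftrightarrow> x \<in> R)"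
    by blast
qed

section \<open>Back and forth\<close>

text \<open>Relations instead of functions make the notion symmetric under converse. Being
  single-valued and injective follows for partial orders from
  \<open>partial_iso_eq_iff\<close>.\<close>

definition partial_iso :: "'a set \<Rightarrow> 'a rel \<Rightarrow> 'b set \<Rightarrow> 'b rel \<Rightarrow> ('a \<times> 'b) set \<Rightarrow> bool" where
  "partial_iso A r B s p \<longleftrightarrow> p \<subseteq> A \<times> B \<and>
     (\<forall>(a, b)\<in>p. \<forall>(a', b')\<in>p. (a, a') \<in> r \<longleftrightarrow> (b, b') \<in> s)"

lemma partial_isoD:
  assumes "partial_iso A r B s p"
  shows "(a, b) \<in> p \<Longrightarrow> a \<in> A" "(a, b) \<in> p \<Longrightarrow> b \<in> B"
    and "(a, b) \<in> p \<Longrightarrow> (a', b') \<in> p \<Longrightarrow> (a, a') \<in> r \<longleftrightarrow> (b, b') \<in> s"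
  using assms unfolding partial_iso_def by blast+

lemma partial_iso_converse: "partial_iso A r B s p \<Longrightarrow> partial_iso B s A r (p\<inverse>)"
  unfolding partial_iso_def by blast

lemma partial_iso_eq_iff:
  assumes "partial_order_on A r" "partial_order_on B s" "partial_iso A r B s p"
    and "(a, b) \<in> p" "(a', b') \<in> p"
  shows "a = a' \<longleftrightarrow> b = b'"
proof -
  have "a = a' \<longleftrightarrow> (a, a') \<in> r \<and> (a', a) \<in> r"
    using assms partial_order_onD[OF assms(1)] partial_isoD(1)[OF assms(3)]
    by (metis antisymD refl_onD)
  also have "\<dots> \<longleftrightarrow> (b, b') \<in> s \<and> (b', b) \<in> s"
    using assms(4,5) partial_isoD(3)[OF assms(3)] by blast
  also have "\<dots> \<longleftrightarrow> b = b'"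
    using assms partial_order_onD[OF assms(2)] partial_isoD(2)[OF assms(3)]
    by (metis antisymD refl_onD)
  finally show ?thesis .
qed

text \<open>The forth step: the images of the points below and above \<open>a\<close> prescribe the
  position of its partner \<open>m\<close>.\<close>

lemma partial_iso_extend:
  assumes r: "partial_order_on A r" and s: "partial_order_on B s"
    and ext: "one_point_extensible B s"
    and p: "partial_iso A r B s p" "finite p" and a: "a \<in> A"
  shows "\<exists>q. partial_iso A r B s q \<and> finite q \<and> p \<subseteq> q \<and> a \<in> Domain q"
proof (cases "a \<in> Domain p")
  case True
  with p show ?thesis by blast
next
  case False
  note rD = partial_order_onD[OF r] and sD = partial_order_onD[OF s] and pD = partial_isoD[OF p(1)]
  define L where "L = {b. \<exists>c. (c, b) \<in> p \<and> (c, a) \<in> r}"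
  define R where "R = {b. \<exists>c. (c, b) \<in> p \<and> (a, c) \<in> r}"
  have L_iff: "b \<in> L \<longleftrightarrow> (c, a) \<in> r" and R_iff: "b \<in> R \<longleftrightarrow> (a, c) \<in> r" if "(c, b) \<in> p" for c b
    using that partial_iso_eq_iff[OF r s p(1)] by (auto simp: L_def R_def)
  have sub: "L \<subseteq> Range p" "R \<subseteq> Range p"
    by (auto simp: L_def R_def)
  have "\<exists>m\<in>B. \<forall>x\<in>Range p. x \<noteq> m \<and> ((x, m) \<in> s \<longleftrightarrow> x \<in> L) \<and> ((m, x) \<in> s \<longleftrightarrow> x \<in> R)"
  proof (rule ext[unfolded one_point_extensible_def, rule_format], intro conjI sub)
    show "finite (Range p)"
      using p(2) by (rule finite_Range)
    show "Range p \<subseteq> B"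
      using pD(2) by blast
    show "L \<inter> R = {}"
    proof (rule ccontr)
      assume "L \<inter> R \<noteq> {}"
      then obtain b where b: "b \<in> L" "b \<in> R"
        by blast
      then obtain c where c: "(c, b) \<in> p" "(c, a) \<in> r"
        by (auto simp: L_def)
      \<comment> \<open>A preimage of \<open>b\<close> lies both below and above \<open>a\<close>,
        but \<open>a\<close> is outside the domain.\<close>
      then have "c = a"
        using b(2) R_iff rD(3) by (blast dest: antisymD)
      with c(1) False show False
        by blast
    qed
    show "L \<times> R \<subseteq> s"
      using pD(3) rD(2) unfolding L_def R_def by (auto dest: transD)
    show "\<forall>x\<in>Range p. \<forall>l\<in>L. (x, l) \<in> s \<longrightarrow> x \<in> L"
      using pD(3) rD(2) unfolding L_def by (blast dest: transD)
    show "\<forall>x\<in>Range p. \<forall>u\<in>R. (u, x) \<in> s \<longrightarrow> x \<in> R"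
      using pD(3) rD(2) unfolding R_def by (blast dest: transD)
  qed
  then obtain m where m: "m \<in> B" "\<forall>x\<in>Range p. ((x, m) \<in> s \<longleftrightarrow> x \<in> L) \<and> ((m, x) \<in> s \<longleftrightarrow> x \<in> R)"
    by blast
  have "(c, a) \<in> r \<longleftrightarrow> (b, m) \<in> s" "(a, c) \<in> r \<longleftrightarrow> (m, b) \<in> s" if "(c, b) \<in> p" for c b
    using that m(2) L_iff R_iff by blast+
  moreover have "(a, a) \<in> r" "(m, m) \<in> s"
    using a m(1) rD(1) sD(1) by (auto dest: refl_onD)
  ultimately have "partial_iso A r B s (insert (a, m) p)"
    using p(1) a m(1) unfolding partial_iso_def by auto
  with p(2) show ?thesis by blast
qed

text \<open>A generic construction in the style of Rasiowa and Sikorski: each \<open>d\<close> is a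
  requirement that every finite partial isomorphism can be extended to meet. An increasing chain
  meets them one by one, and its union is \<open>G\<close>.\<close>

lemma partial_iso_meets_all:
  assumes "countable D"
    and "partial_iso A r B s p" "finite p"
    and step: "\<And>d p. d \<in> D \<Longrightarrow> partial_iso A r B s p \<Longrightarrow> finite p \<Longrightarrow>
      \<exists>q. partial_iso A r B s q \<and> finite q \<and> p \<subseteq> q \<and> q \<in> d"
  obtains G where "partial_iso A r B s G" "p \<subseteq> G" "\<And>d. d \<in> D \<Longrightarrow> \<exists>q\<in>d. q \<subseteq> G"
proof -
  \<comment> \<open>The trivial requirement \<open>UNIV\<close> keeps the enumerated set nonempty
    even when \<open>D\<close> is empty.\<close>
  define d where "d = from_nat_into (insert UNIV D)"
  have d_mem: "d n \<in> insert UNIV D" for n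
    unfolding d_def by (rule from_nat_into) simp
  have d_step: "\<exists>q. (partial_iso A r B s q \<and> finite q \<and> p \<subseteq> q) \<and> x \<subseteq> q \<and> q \<in> d n"
    if "partial_iso A r B s x \<and> finite x \<and> p \<subseteq> x" for x n
  proof (cases "d n \<in> D")
    case True
    with that step[of "d n" x] show ?thesis by blast
  next
    case False
    with d_mem[of n] that show ?thesis by auto
  qed
  have "\<exists>f. \<forall>n. (partial_iso A r B s (f n) \<and> finite (f n) \<and> p \<subseteq> f n) \<and>
      (f n \<subseteq> f (Suc n) \<and> f (Suc n) \<in> d n)"
    by (rule dependent_nat_choice) (use assms(2,3) d_step in blast)+
  then obtain f where f: "\<And>n. partial_iso A r B s (f n)" "\<And>n. p \<subseteq> f n"
    "\<And>n. f n \<subseteq> f (Suc n)" "\<And>n. f (Suc n) \<in> d n"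
    by blast
  have "mono f"
    using f(3) by (simp add: mono_iff_le_Suc)
  \<comment> \<open>Being a partial isomorphism concerns two pairs at a time, and in a chain any two
    pairs occur at a common stage.\<close>
  then have common: "\<exists>n. x \<in> f n \<and> y \<in> f n" if "x \<in> f i" "y \<in> f j" for x y i j
    using that by (intro exI[of _ "max i j"]) (meson max.cobounded1 max.cobounded2 monoD subsetD)
  have "partial_iso A r B s (\<Union>n. f n)"
    unfolding partial_iso_def
  proof (intro conjI)
    show "(\<Union>n. f n) \<subseteq> A \<times> B"
      using f(1) unfolding partial_iso_def by blast
    show "\<forall>(a, b)\<in>\<Union>n. f n. \<forall>(a', b')\<in>\<Union>n. f n. (a, a') \<in> r \<longleftrightarrow> (b, b') \<in> s"
      using common partial_isoD(3)[OF f(1)] by (clarsimp, metis)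
  qed
  moreover have "\<exists>q\<in>e. q \<subseteq> (\<Union>n. f n)" if "e \<in> D" for e
  proof -
    have "e \<in> range d"
      using subset_range_from_nat_into[of "insert UNIV D"] that assms(1) by (auto simp: d_def)
    with f(4) show ?thesis by blast
  qed
  ultimately show thesis
    using that f(2) by blast
qed

section \<open>Universality and ultrahomogeneity\<close>

lemma partial_iso_embedding:
  assumes r: "partial_order_on A r" and s: "partial_order_on B s"
    and G: "partial_iso A r B s G" and dom: "A \<subseteq> Domain G"
  obtains f where "is_embedding A r B s f" "\<And>a b. (a, b) \<in> G \<longleftrightarrow> a \<in> A \<and> b = f a"
proof -
  have "\<forall>a\<in>A. \<exists>b. (a, b) \<in> G"
    using dom by blast
  then obtain f where "\<forall>a\<in>A. (a, f a) \<in> G"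
    by (rule bchoice[THEN exE])
  then have f: "(a, f a) \<in> G" if "a \<in> A" for a
    using that by blast
  have "is_embedding A r B s f"
    unfolding is_embedding_def inj_on_def
  proof (intro conjI ballI impI)
    show "a = b" if "a \<in> A" "b \<in> A" "f a = f b" for a b
      using partial_iso_eq_iff[OF r s G f f] that by blast
    show "f ` A \<subseteq> B"
      using partial_isoD(2)[OF G f] by blast
    show "(a, b) \<in> r \<longleftrightarrow> (f a, f b) \<in> s" if "a \<in> A" "b \<in> A" for a b
      using partial_isoD(3)[OF G f f] that by blast
  qed
  moreover have "(a, b) \<in> G \<longleftrightarrow> a \<in> A \<and> b = f a" for a b
    using partial_isoD(1)[OF G] partial_iso_eq_iff[OF r s G] f by blast
  ultimately show thesis
    by (rule that)
qed

lemma one_point_extensible_universal: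
  assumes "partial_order_on A r" "partial_order_on B s" "one_point_extensible B s" "countable A"
  shows "\<exists>f. is_embedding A r B s f"
proof -
  obtain G where G: "partial_iso A r B s G" and
    "\<And>d. d \<in> (\<lambda>a. {q. a \<in> Domain q}) ` A \<Longrightarrow> \<exists>q\<in>d. q \<subseteq> G"
  \<comment> \<open>Going forth only: start from the empty map and require each point of
    \<open>A\<close> to enter the domain.\<close>
  proof (rule partial_iso_meets_all)
    show "countable ((\<lambda>a. {q :: ('a \<times> 'b) set. a \<in> Domain q}) ` A)"
      using assms(4) by simp
    show "partial_iso A r B s {}"
      by (simp add: partial_iso_def)
  qed (use partial_iso_extend[OF assms(1-3)] in auto)
  then have "A \<subseteq> Domain G" by blast
  then show ?thesis
    using partial_iso_embedding[OF assms(1,2) G] by blast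
qed

lemma one_point_extensible_ultrahomogeneous:
  assumes r: "partial_order_on A r" and ext: "one_point_extensible A r" and A: "countable A"
  shows "ultrahomogeneous A r"
  unfolding ultrahomogeneous_def
proof (intro allI impI, elim conjE)
  fix S T f
  assume S: "finite S" "S \<subseteq> A" and T: "T \<subseteq> A" and f: "is_isomorphism S r T r f"
  define p where "p = (\<lambda>x. (x, f x)) ` S"
  have "f ` S = T"
    using f by (simp add: is_isomorphism_def bij_betw_def)
  then have p: "partial_iso A r A r p" "finite p"
    using f S T by (auto simp: partial_iso_def p_def is_isomorphism_def)
  \<comment> \<open>The back step is the forth step for the converse relation.\<close>
  have range_step: "\<exists>q. partial_iso A r A r q \<and> finite q \<and> p \<subseteq> q \<and> b \<in> Range q"
    if p: "partial_iso A r A r p" "finite p" and b: "b \<in> A" for p b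
  proof -
    obtain q where q: "partial_iso A r A r q" "finite q" "p\<inverse> \<subseteq> q" "b \<in> Domain q"
      using partial_iso_extend[OF r r ext partial_iso_converse[OF p(1)] _ b] p(2) by auto
    then show ?thesis
      using partial_iso_converse[OF q(1)] by (intro exI[of _ "q\<inverse>"]) auto
  qed
  \<comment> \<open>The domain requirements make the limit total, the range requirements make it
    onto.\<close>
  define D where "D =
    (\<lambda>a. {q :: ('a \<times> 'a) set. a \<in> Domain q}) ` A \<union> (\<lambda>b. {q. b \<in> Range q}) ` A"
  have "countable D"
    using A by (simp add: D_def)
  moreover have "\<exists>q. partial_iso A r A r q \<and> finite q \<and> p \<subseteq> q \<and> q \<in> d"
    if "d \<in> D" "partial_iso A r A r p" "finite p" for d p
    using that range_step[of p] partial_iso_extend[OF r r ext, of p] by (auto simp: D_def)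
  ultimately obtain G where G: "partial_iso A r A r G" "p \<subseteq> G"
    and meets: "\<And>d. d \<in> D \<Longrightarrow> \<exists>q\<in>d. q \<subseteq> G"
    using partial_iso_meets_all[OF _ p, of D] by metis
  have "A \<subseteq> Domain G" and ran: "A \<subseteq> Range G"
    using meets unfolding D_def by blast+
  then obtain g where g: "is_embedding A r A r g" "\<And>a b. (a, b) \<in> G \<longleftrightarrow> a \<in> A \<and> b = g a"
    using partial_iso_embedding[OF r r G(1)] by blast
  have "A \<subseteq> g ` A"
    using ran g(2) by blast
  then have "is_isomorphism A r A r g"
    using g(1) by (auto simp: is_embedding_def is_isomorphism_def bij_betw_def)
  moreover have "g x = f x" if "x \<in> S" for x
    using that G(2) g(2) by (auto simp: p_def)
  ultimately show "\<exists>g. is_isomorphism A r A r g \<and> (\<forall>x\<in>S. g x = f x)"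
    by blast
qed

theorem theorem3p10:
  "partial_order_on P_in le_in \<and>
   countable P_in \<and>
   ultrahomogeneous P_in le_in \<and>
   (\<forall>(X :: 'a set) r. countable X \<and> partial_order_on X r \<longrightarrow>
      (\<exists>f. is_embedding X r P_in le_in f))"
proof (intro conjI allI impI)
  show "ultrahomogeneous P_in le_in"
    by (rule one_point_extensible_ultrahomogeneous[OF partial_order_on_le_in
          one_point_extensible_P_in]) simp
  show "\<exists>f. is_embedding X r P_in le_in f" if "countable X \<and> partial_order_on X r"
    for X :: "'a set" and r
    using that partial_order_on_le_in one_point_extensible_P_in
    by (blast intro: one_point_extensible_universal)
qed (simp_all add: partial_order_on_le_in)

end
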